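(* The only solutions $(k,p,q,n)$ in the positive integers of the exponential Diophantine equation $(2n + 1)^k\left((2n)^p - 1\right) = (2n)^q - 1$ are $(k,p,q,n) = (2,3,6,1)$ and $(k,p,q,n) = (1,1,2,n)$ for all positive integers $n$. *)

theory Defs imports Main begin

end

theory Submission imports Defs begin

text \<open>
  Put x = 2 n. The equation says that x^p - 1 divides x^q - 1 with cofactor (x + 1)^k, and
  divisibility forces p to divide q. The proof plays two facts against each other: the power
  (x + 1)^k is at least x^(q - p), but x^q - 1 can only contain a high power of the
  odd number x + 1 if the exponent q contains almost the same power.

  The second fact is a form of ``lifting the exponent'': if d is odd and y is 1 modulo d, then a
  power of d dividing 1 + y + ... + y^(m - 1) divides m
  (\<open>odd_power_dvd_geometric_sum\<close>). It is needed for d = x + 1, which may be composite, so it is proved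
  directly for an arbitrary odd d, without passing to prime factors.

  If p is even, then x^p is 1 modulo x + 1, and (x + 1)^k, which equals the sum of the q / p
  powers of x^p, would divide q / p and hence be too large. If p is odd, then
  reduction modulo x + 1 shows that q = 2 h is even, and the lifting lemma with y = x^2 gives that
  (x + 1)^(k - 1) divides h. Since p divides h, this yields x^h + 1 \<le> (x + 1) h, which
  leaves only h = 1 for arbitrary x, and h \<le> 3 for x = 2.
\<close>

section \<open>Powers of an odd number dividing a geometric sum\<close>

lemma geometric_sum_cong_length:
  fixes d y :: int
  assumes "d dvd y - 1"
  shows "d dvd (\<Sum>i<m. y ^ i) - int m"
proof -
  have "d dvd y ^ i - 1" for i
    using assms dvd_trans[of d "y - 1" "y ^ i - 1"] by (simp add: power_diff_1_eq)
  then have "d dvd (\<Sum>i<m. y ^ i - 1)"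
    by (intro dvd_sum) auto
  then show ?thesis by (simp add: sum_subtractf)
qed

lemma geometric_sum_mult_length:
  fixes y :: int
  shows "(\<Sum>i<n * m. y ^ i) = (\<Sum>i<n. y ^ i) * (\<Sum>j<m. (y ^ n) ^ j)"
proof (induction m)
  case (Suc m)
  have "(\<Sum>i<l + n. y ^ i) = (\<Sum>i<l. y ^ i) + y ^ l * (\<Sum>i<n. y ^ i)" for l
    by (induction n) (simp_all add: power_add algebra_simps)
  from this[of "n * m"] show ?case
    using Suc.IH by (simp add: distrib_left mult.commute add.commute flip: power_mult)
qed simp

text \<open>
  Modulo d^2 the powers of y = 1 + t d are 1 + i t d, so the sum is
  d + t d * (d (d - 1) / 2). Oddness of d makes the second term a multiple of d^2.
\<close>

lemma geometric_sum_odd_length: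
  fixes y :: int and n :: nat
  assumes "odd n" and "int n dvd y - 1"
  obtains s where "(\<Sum>i<n. y ^ i) = int n * (1 + int n * s)"
proof -
  obtain t where "y - 1 = int n * t"
    using assms(2) by (elim dvdE)
  then have t: "y = 1 + int n * t" by linarith
  have pow: "(int n)\<^sup>2 dvd y ^ i - (1 + int i * (int n * t))" for i
  proof (induction i)
    case (Suc i)
    then obtain c where "y ^ i - (1 + int i * (int n * t)) = (int n)\<^sup>2 * c"
      by (elim dvdE)
    then have c: "y ^ i = 1 + int i * (int n * t) + (int n)\<^sup>2 * c"
      by linarith
    have "y ^ Suc i - (1 + int (Suc i) * (int n * t)) = (int n)\<^sup>2 * (c * y + int i * t\<^sup>2)"
      unfolding power_Suc c by (simp add: t algebra_simps power2_eq_square)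
    then show ?case by simp
  qed simp
  obtain r where r: "n = 2 * r + 1"
    using assms(1) by (elim oddE)
  have gauss: "(\<Sum>i<n. int i) = int n * int r"
  proof -
    have "2 * (\<Sum>i<l. int i) = int l * (int l - 1)" for l
      by (induction l) (auto simp: algebra_simps)
    from this[of n] show ?thesis using r by simp
  qed
  have "(int n)\<^sup>2 dvd (\<Sum>i<n. y ^ i - (1 + int i * (int n * t)))"
    using pow by (intro dvd_sum) auto
  also have "(\<Sum>i<n. y ^ i - (1 + int i * (int n * t)))
      = (\<Sum>i<n. y ^ i) - (int n + (\<Sum>i<n. int i) * (int n * t))"
    by (simp add: sum_subtractf sum.distrib sum_distrib_right)
  finally obtain c where
    "(\<Sum>i<n. y ^ i) - (int n + int n * int r * (int n * t)) = (int n)\<^sup>2 * c"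
    unfolding gauss by (elim dvdE)
  then have "(\<Sum>i<n. y ^ i) = int n * (1 + int n * (int r * t + c))"
    by (simp add: algebra_simps power2_eq_square)
  then show ?thesis by (rule that)
qed

text \<open>
  One factor d of the sum forces d to divide m; cutting the sum into m / d blocks of length d
  splits off a factor that is d times a unit modulo d, and leaves a geometric sum of
  length m / d with ratio y^d that carries the remaining powers of d.
\<close>

lemma odd_power_dvd_geometric_sum:
  fixes y :: int and n :: nat
  assumes "odd n" and "int n dvd y - 1" and "int n ^ j dvd (\<Sum>i<m. y ^ i)"
  shows "n ^ j dvd m"
  using assms(2,3)
proof (induction j arbitrary: y m)
  case (Suc j)
  have "int n dvd (\<Sum>i<m. y ^ i)"
    using Suc.prems(2) by (metis dvd_mult_left power_Suc)
  then have "int n dvd int m"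
    using geometric_sum_cong_length[OF Suc.prems(1), of m] by (metis dvd_diff_right_iff)
  then obtain l where l: "m = n * l" by auto
  obtain s where s: "(\<Sum>i<n. y ^ i) = int n * (1 + int n * s)"
    using geometric_sum_odd_length[OF assms(1) Suc.prems(1)] .
  have "int n * int n ^ j dvd int n * ((1 + int n * s) * (\<Sum>i<l. (y ^ n) ^ i))"
    using Suc.prems(2) unfolding l geometric_sum_mult_length s by (simp add: mult.assoc)
  then have "int n ^ j dvd (1 + int n * s) * (\<Sum>i<l. (y ^ n) ^ i)"
    using assms(1) by (subst (asm) dvd_mult_cancel_left) auto
  moreover have "coprime (int n ^ j) (1 + int n * s)"
  proof -
    have "coprime (int n) (1 + int n * s)"
      using gcd_add_mult[of "int n" s 1] by (simp add: coprime_iff_gcd_eq_1 ac_simps)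
    then show ?thesis by simp
  qed
  ultimately have "int n ^ j dvd (\<Sum>i<l. (y ^ n) ^ i)"
    by (simp add: coprime_dvd_mult_right_iff)
  moreover have "int n dvd y ^ n - 1"
    using Suc.prems(1) by (simp add: power_diff_1_eq)
  ultimately have "n ^ j dvd l" by (intro Suc.IH)
  then show ?case by (simp add: l)
qed simp

section \<open>Constraints on the exponents\<close>

text \<open>
  Euclid's algorithm on exponents: x^q - 1 is congruent to x^(q - p) - 1 modulo x^p - 1, and for
  q < p the number x^q - 1 is too small to be a nonzero multiple.
\<close>

lemma power_minus_1_dvd_imp_exponent_dvd:
  fixes x :: int
  assumes "x \<ge> 2" and "x ^ p - 1 dvd x ^ q - 1"
  shows "p dvd q"
  using assms(2)
proof (induction q rule: less_induct)
  case (less q)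
  show ?case
  proof (cases "p = 0 \<or> q < p")
    case True
    have "x ^ q = 1"
    proof (cases "p = 0")
      case True
      then show ?thesis using less.prems by simp
    next
      case False
      then have "x ^ q < x ^ p" using True assms(1) by simp
      moreover have "x ^ q \<ge> 1" using assms(1) by simp
      ultimately show ?thesis using zdvd_imp_le[OF less.prems] by linarith
    qed
    then have "q = 0" using assms(1) by (cases q) (auto simp: zmult_eq_1_iff)
    then show ?thesis by simp
  next
    case False
    then obtain r where r: "q = p + r" by (metis le_iff_add not_less)
    have "x ^ q - 1 = x ^ r * (x ^ p - 1) + (x ^ r - 1)"
      by (simp add: r power_add algebra_simps)
    then have "x ^ p - 1 dvd x ^ r - 1"
      using less.prems by (metis dvd_add_right_iff dvd_triv_right)
    then have "p dvd r" using less.IH[of r] False r by simp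
    then show ?thesis by (simp add: r)
  qed
qed

lemma linear_less_power:
  fixes x :: int
  assumes "x \<ge> 3" and "h \<ge> 2"
  shows "(x + 1) * int h < x ^ h + 1"
  using assms(2)
proof (induction h rule: dec_induct)
  case base
  have "3 * x \<le> x\<^sup>2" using assms(1) by (simp add: power2_eq_square)
  then show ?case using assms(1) by simp
next
  case (step i)
  have "(x + 1) * int (Suc i) \<le> (x + 1) * (3 * int i)"
    using assms(1) step.hyps by (intro mult_left_mono) auto
  also have "\<dots> = 3 * ((x + 1) * int i)" by simp
  also have "\<dots> \<le> 3 * x ^ i" using step.IH by simp
  also have "\<dots> \<le> x ^ Suc i" using assms(1) by simp
  finally show ?case by simp
qed

lemma three_mult_less_two_power:
  assumes "h \<ge> 4"
  shows "3 * int h < 2 ^ h + 1"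
  using assms by (induction h rule: dec_induct) auto

text \<open>
  Here the geometric sum of ratio x^p equals the power of x + 1, so its whole value would divide
  its number of terms, although all terms but the first exceed 1.
\<close>

lemma even_exponent_impossible:
  fixes n :: nat
  assumes "n > 0" "even p" "p > 0" "p < q"
    and eq: "(2 * int n + 1) ^ k * ((2 * int n) ^ p - 1) = (2 * int n) ^ q - 1"
  shows False
proof -
  define x where "x = 2 * int n"
  have x: "x \<ge> 2" using assms(1) by (simp add: x_def)
  have eq: "(x + 1) ^ k * (x ^ p - 1) = x ^ q - 1" using eq by (simp add: x_def)
  have "p dvd q"
    using eq by (intro power_minus_1_dvd_imp_exponent_dvd[OF x]) (metis dvd_triv_right)
  then obtain m where m: "q = p * m" by auto
  have "m \<ge> 2" using m assms(4) by (cases m; cases "m - 1") auto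
  have xp: "x ^ p \<ge> 2" using self_le_power[of x p] x assms(3) by linarith
  have "(x ^ p - 1) * (x + 1) ^ k = (x ^ p - 1) * (\<Sum>i<m. (x ^ p) ^ i)"
    using eq by (simp add: m power_mult flip: power_diff_1_eq) (simp add: mult.commute)
  then have sum: "(x + 1) ^ k = (\<Sum>i<m. (x ^ p) ^ i)" using xp by simp
  obtain a where a: "p = 2 * a" using assms(2) by auto
  have "x + 1 dvd x\<^sup>2 - 1" by (simp add: power2_eq_square square_diff_one_factored)
  then have "x + 1 dvd x ^ p - 1"
    unfolding a power_mult by (simp add: power_diff_1_eq)
  then have "(2 * n + 1) ^ k dvd m"
    using sum by (intro odd_power_dvd_geometric_sum[of _ "x ^ p"]) (auto simp: x_def add.commute)
  then have "(2 * n + 1) ^ k \<le> m" using \<open>m \<ge> 2\<close> by (simp add: dvd_imp_le)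
  then have "int ((2 * n + 1) ^ k) \<le> int m" by (simp only: of_nat_le_iff)
  then have "(\<Sum>i<m. (x ^ p) ^ i) \<le> int m"
    using sum by (simp add: x_def add.commute)
  moreover have "(\<Sum>i<m. 1) < (\<Sum>i<m. (x ^ p) ^ i)"
  proof (rule sum_strict_mono_ex1)
    show "\<forall>i\<in>{..<m}. 1 \<le> (x ^ p) ^ i" using xp by simp
    show "\<exists>i\<in>{..<m}. 1 < (x ^ p) ^ i" using xp \<open>m \<ge> 2\<close> by (intro bexI[of _ 1]) auto
  qed simp
  ultimately show False by simp
qed

text \<open>
  Writing x = 2 n, one factor x + 1 on each side cancels in
  (x + 1)^k (x^p - 1) = (x + 1) (x - 1) (1 + x^2 + ... + x^(2 (h - 1))). Since x - 1 is coprime to the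
  odd number x + 1, the remaining power of x + 1 divides the geometric sum of ratio x^2, hence h.
  The inequality comes from inserting (x + 1)^(k - 1) \<le> h and p \<le> h into the equation and
  dividing by x^h - 1.
\<close>

lemma odd_exponent_bounds:
  fixes n :: nat
  assumes "n > 0" "odd p" "p < q" "k > 0"
    and eq: "(2 * int n + 1) ^ k * ((2 * int n) ^ p - 1) = (2 * int n) ^ q - 1"
  obtains h where "q = 2 * h" "p dvd h" "h > 0" "(2 * n + 1) ^ (k - 1) dvd h"
    "(2 * int n) ^ h + 1 \<le> (2 * int n + 1) * int h"
proof -
  define x where "x = 2 * int n"
  have x: "x \<ge> 2" using assms(1) by (simp add: x_def)
  have eq: "(x + 1) ^ k * (x ^ p - 1) = x ^ q - 1" using eq by (simp add: x_def)
  have "p dvd q"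
    using eq by (intro power_minus_1_dvd_imp_exponent_dvd[OF x]) (metis dvd_triv_right)
  obtain l where l: "k = Suc l" using assms(4) gr0_implies_Suc by blast
  have "even q"
  proof (rule ccontr)
    assume "odd q"
    have "(- x) - 1 dvd (- x) ^ q - 1" by (simp only: power_diff_1_eq dvd_triv_left)
    then have "- (x + 1) dvd - (x ^ q + 1)" using \<open>odd q\<close> by simp
    then have "x + 1 dvd x ^ q + 1" by (simp only: minus_dvd_iff dvd_minus_iff)
    moreover have "x + 1 dvd x ^ q - 1" using eq l by (metis dvd_mult2 dvd_triv_left power_Suc)
    ultimately have "x + 1 dvd (x ^ q + 1) - (x ^ q - 1)" by (rule dvd_diff)
    then have "x + 1 dvd 2" by simp
    then show False using x zdvd_imp_le[of "x + 1" 2] by simp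
  qed
  then obtain h where h: "q = 2 * h" by auto
  have "h > 0" using assms(3) h by simp
  have "p dvd h" using \<open>p dvd q\<close> assms(2) unfolding h
    by (simp add: coprime_dvd_mult_right_iff)
  have "(x + 1) * ((x + 1) ^ l * (x ^ p - 1)) = (x + 1) * ((x - 1) * (\<Sum>i<h. (x\<^sup>2) ^ i))"
  proof -
    have "(x + 1) * ((x - 1) * (\<Sum>i<h. (x\<^sup>2) ^ i)) = (x\<^sup>2 - 1) * (\<Sum>i<h. (x\<^sup>2) ^ i)"
      by (simp add: power2_eq_square square_diff_one_factored mult.assoc)
    also have "\<dots> = x ^ q - 1"
      by (simp add: h power_mult flip: power_diff_1_eq)
    finally show ?thesis using eq l by (simp add: mult.assoc)
  qed
  then have "(x + 1) ^ l * (x ^ p - 1) = (x - 1) * (\<Sum>i<h. (x\<^sup>2) ^ i)"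
    using x by simp
  then have "(x + 1) ^ l dvd (x - 1) * (\<Sum>i<h. (x\<^sup>2) ^ i)" by (metis dvd_triv_left)
  moreover have "coprime ((x + 1) ^ l) (x - 1)"
  proof -
    have "gcd (x + 1) (x - 1) = gcd 2 (x - 1)"
      using gcd_diff1[of "x + 1" "x - 1"] by simp
    also have "\<dots> = 1" by (simp add: x_def flip: coprime_iff_gcd_eq_1)
    finally have "coprime (x + 1) (x - 1)" by (simp only: coprime_iff_gcd_eq_1)
    then show ?thesis by simp
  qed
  ultimately have "(x + 1) ^ l dvd (\<Sum>i<h. (x\<^sup>2) ^ i)"
    by (simp add: coprime_dvd_mult_right_iff)
  moreover have "x + 1 dvd x\<^sup>2 - 1" by (simp add: power2_eq_square square_diff_one_factored)
  ultimately have dvd: "(2 * n + 1) ^ l dvd h"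
    by (intro odd_power_dvd_geometric_sum[of _ "x\<^sup>2"]) (auto simp: x_def add.commute)
  then have "(2 * n + 1) ^ l \<le> h" using \<open>h > 0\<close> by (simp add: dvd_imp_le)
  then have "int ((2 * n + 1) ^ l) \<le> int h" by (simp only: of_nat_le_iff)
  then have le: "(x + 1) ^ l \<le> int h" by (simp add: x_def add.commute)
  have "p \<le> h" using \<open>p dvd h\<close> \<open>h > 0\<close> by (rule dvd_imp_le)
  then have "x ^ p \<le> x ^ h" using x by simp
  have xh: "x ^ h \<ge> 2" using self_le_power[of x h] x \<open>h > 0\<close> by linarith
  have "(x ^ h + 1) * (x ^ h - 1) = x ^ q - 1"
    by (simp add: h mult.commute[of 2 h] power_mult power2_eq_square algebra_simps)
  also have "\<dots> = (x + 1) * (x + 1) ^ l * (x ^ p - 1)" using eq l by simp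
  also have "\<dots> \<le> (x + 1) * int h * (x ^ h - 1)"
    using x le by (intro mult_mono diff_right_mono \<open>x ^ p \<le> x ^ h\<close>) auto
  finally have "x ^ h + 1 \<le> (x + 1) * int h" using xh by simp
  then show ?thesis
    using that h \<open>p dvd h\<close> \<open>h > 0\<close> dvd l by (simp add: x_def)
qed

section \<open>The solutions\<close>

theorem proposition11:
  shows "{(k, p, q, n :: nat). k > (0::nat) \<and> p > (0::nat) \<and> q > (0::nat) \<and> n > 0 \<and>
            (2 * int n + 1) ^ k * ((2 * int n) ^ p - 1) = (2 * int n) ^ q - 1}
         = {(2, 3, 6, 1)} \<union> {(1, 1, 2, n) | n. n > 0}"
proof -
  have solution: "(k = 2 \<and> p = 3 \<and> q = 6 \<and> n = 1) \<or> (k = 1 \<and> p = 1 \<and> q = 2)"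
    if pos: "k > 0" "p > 0" "q > 0" "n > 0"
      and eq: "(2 * int n + 1) ^ k * ((2 * int n) ^ p - 1) = (2 * int n) ^ q - 1"
    for k p q n :: nat
  proof -
    have "p < q"
    proof -
      have "1 < (2 * int n + 1) ^ k" using pos by (intro one_less_power) auto
      moreover have "(2 * int n) ^ p - 1 > 0" using pos one_less_power[of "2 * int n" p] by simp
      ultimately have "1 * ((2 * int n) ^ p - 1) < (2 * int n) ^ q - 1"
        unfolding eq[symmetric] by (rule mult_strict_right_mono)
      then have "(2 * int n) ^ p < (2 * int n) ^ q" by simp
      then show ?thesis using pos by (intro power_less_imp_less_exp[of "2 * int n"]) auto
    qed
    have "odd p" using even_exponent_impossible pos \<open>p < q\<close> eq by blast
    obtain h where h: "q = 2 * h" "p dvd h" "h > 0" "(2 * n + 1) ^ (k - 1) dvd h"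
      and bound: "(2 * int n) ^ h + 1 \<le> (2 * int n + 1) * int h"
      using odd_exponent_bounds[OF pos(4) \<open>odd p\<close> \<open>p < q\<close> pos(1) eq] .
    show ?thesis
    proof (cases "h = 1")
      case True
      then have "p = 1" "(2 * n + 1) ^ (k - 1) = 1" using h by auto
      then have "k = 1" using pos by (cases "k - 1") auto
      then show ?thesis using True h \<open>p = 1\<close> by simp
    next
      case False
      then have "h \<ge> 2" using h(3) by simp
      have "n = 1"
        using linear_less_power[of "2 * int n" h] bound \<open>h \<ge> 2\<close> pos(4) by linarith
      have "h \<le> 3"
        using three_mult_less_two_power[of h] bound \<open>n = 1\<close> by fastforce
      have "(3 :: nat) ^ (k - 1) \<le> 3"
        using dvd_imp_le[OF h(4) h(3)] \<open>n = 1\<close> \<open>h \<le> 3\<close> by simp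
      then have "(3 :: nat) ^ (k - 1) \<le> 3 ^ 1" by simp
      then have "k - 1 \<le> 1" by (subst (asm) power_increasing_iff) auto
      then have k: "k = 1 \<or> k = 2" using pos by linarith
      have "p \<le> 3" using dvd_imp_le[OF h(2,3)] \<open>h \<le> 3\<close> by simp
      then have p: "p = 1 \<or> p = 3" using \<open>odd p\<close> by presburger
      have "h = 2 \<or> h = 3" using \<open>h \<ge> 2\<close> \<open>h \<le> 3\<close> by linarith
      then show ?thesis using k p eq h(1) \<open>n = 1\<close> by auto
    qed
  qed
  show ?thesis (is "?S = ?T")
  proof (rule subset_antisym)
    show "?S \<subseteq> ?T"
    proof
      fix z assume "z \<in> ?S"
      then obtain k p q n where z: "z = (k, p, q, n)" and "n > 0"
        and "(k = 2 \<and> p = 3 \<and> q = 6 \<and> n = 1) \<or> (k = 1 \<and> p = 1 \<and> q = 2)"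
        using solution by blast
      then show "z \<in> ?T" by auto
    qed
    show "?T \<subseteq> ?S" by (auto simp: power2_eq_square algebra_simps)
  qed
qed

end
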